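(* Let $(a_n)_{n\ge1}$ be defined by $a_1=1$ and $a_n=a_{n-1}+\operatorname{lcm}(n,a_{n-1})$ for $n\ge2$. For a prime $p$ and $m\ge1$ let $S^{(1)}_p(m)=\#\{q\le m:\ q\in\mathbb{P},\ q\ne3,\ q\equiv-1\pmod p\}$ and, for $n\ge2$, $\delta^{(1)}_p(n)=\max\{0,\ v_p(n)-S^{(1)}_p(n-1)\}$. For a prime $p$ let $t_0(p)$ be the least integer $t\ge1$ such that $S^{(1)}_p(p^k-1)\ge k$ for all $k\ge t$ (such $t$ exists). For $P_0\ge2$ let $N^*(P_0)=\max_{p\le P_0}p^{t_0(p)}$ (maximum over primes). Then for every fixed $P_0\ge 2$, every integer $n\ge N^*(P_0)$ and every prime $p\le P_0$, we have $\delta^{(1)}_p(n)=0$.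
   Context: $\mathbb{P}$ denotes the set of primes and $v_p$ the $p$-adic valuation. *)

theory Defs
  imports Complex_Main "HOL-Number_Theory.Number_Theory"
begin

text \<open>The recursion starts at index 1; the value at 0 is a dummy. Nothing below refers to this
  sequence: \<open>S1\<close> and \<open>delta1\<close> are given by prime counts and valuations alone.\<close>

fun a_seq :: "nat \<Rightarrow> nat" where
  "a_seq 0 = 0"
| "a_seq (Suc 0) = 1"
| "a_seq (Suc (Suc n)) = a_seq (Suc n) + lcm (Suc (Suc n)) (a_seq (Suc n))"

definition S1 :: "nat \<Rightarrow> nat \<Rightarrow> nat" where
  "S1 p m = card {q::nat. q \<le> m \<and> prime q \<and> q \<noteq> 3 \<and> [int q = -1] (mod int p)}"

definition delta1 :: "nat \<Rightarrow> nat \<Rightarrow> int" where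
  "delta1 p n = max 0 (int (multiplicity p n) - int (S1 p (n - 1)))"

definition t0_admissible :: "nat \<Rightarrow> nat \<Rightarrow> bool" where
  "t0_admissible p t \<longleftrightarrow> 1 \<le> t \<and> (\<forall>k\<ge>t. k \<le> S1 p (p ^ k - 1))"

definition t0 :: "nat \<Rightarrow> nat" where
  "t0 p = (LEAST t. t0_admissible p t)"

definition Nstar :: "real \<Rightarrow> nat" where
  "Nstar P0 = Max {p ^ t0 p | p::nat. prime p \<and> real p \<le> P0}"

end

theory Submission
  imports Defs "HOL-Computational_Algebra.Polynomial" "HOL-Real_Asymp.Real_Asymp"
begin

text \<open>Once \<open>t\<^sub>0(p)\<close> is known to exist, the claim follows by comparing \<open>n\<close> with
  \<open>p\<close> to the power \<open>max (v\<^sub>p(n)) (t\<^sub>0(p))\<close>. Existence requires that at least \<open>log\<^sub>p x\<close> primes up to \<open>x\<close> are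
  congruent to \<open>-1\<close> modulo \<open>p\<close>. No Dirichlet \<open>L\<close>-functions are needed for this: for odd \<open>p\<close>, all
  prime factors of the Chebyshev value \<open>U\<^sub>p\<^sub>-\<^sub>1(n)\<close> are \<open>p\<close> or \<open>\<plusminus>1\<close> modulo \<open>p\<close>, and \<open>U\<^sub>p\<^sub>-\<^sub>1(n)\<close> is congruent
  to the Legendre symbol of \<open>n\<^sup>2 - 1\<close> modulo \<open>p\<close>. So if \<open>n\<^sup>2 - 1\<close> is a nonresidue, \<open>U\<^sub>p\<^sub>-\<^sub>1(n)\<close> has a
  prime factor congruent to \<open>-1\<close>. A sieve shows that logarithmically few primes cannot supply
  divisors for all these values. For \<open>p = 2\<close> the same sieve is applied to \<open>6n + 1\<close>.\<close>

section \<open>Prime divisors of Chebyshev values\<close>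

text \<open>\<open>(x + \<surd>(x\<^sup>2 - 1))\<^sup>n = pellA x n + pellB x n * \<surd>(x\<^sup>2 - 1)\<close>; these are the Chebyshev polynomials
  \<open>T\<^sub>n\<close> and \<open>U\<^sub>n\<^sub>-\<^sub>1\<close>.\<close>

fun pellA pellB :: "'a::comm_ring_1 \<Rightarrow> nat \<Rightarrow> 'a" where
  "pellA x 0 = 1" 
| "pellB x 0 = 0"
| "pellA x (Suc n) = x * pellA x n + (x\<^sup>2 - 1) * pellB x n"
| "pellB x (Suc n) = pellA x n + x * pellB x n"

text \<open>Lets \<open>pellB\<close>, evaluated at the polynomial \<open>[:0, 1:]\<close>, serve as
  the integer polynomial in the sieve.\<close>

lemma poly_pell:
  "poly (pellA f n) x = pellA (poly f x) n" "poly (pellB f n) x = pellB (poly f x) n"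
  by (induction n) (auto simp: power2_eq_square)

text \<open>The element x + sqrt(x^2 - 1) has norm 1, and norms are multiplicative.\<close>

lemma pell_norm: "(pellA x n)\<^sup>2 - (x\<^sup>2 - 1) * (pellB x n)\<^sup>2 = 1"
proof (induction n)
  case (Suc n)
  have "(pellA x (Suc n))\<^sup>2 - (x\<^sup>2 - 1) * (pellB x (Suc n))\<^sup>2
      = (pellA x n)\<^sup>2 - (x\<^sup>2 - 1) * (pellB x n)\<^sup>2"
    by (simp add: power2_eq_square algebra_simps)
  with Suc show ?case by simp
qed simp

lemma pell_add:
  "pellA x (m + n) = pellA x m * pellA x n + (x\<^sup>2 - 1) * pellB x m * pellB x n"
  "pellB x (m + n) = pellA x m * pellB x n + pellB x m * pellA x n"
proof (induction m)
  case (Suc m)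
  {
    case 1
    show ?case
      unfolding add_Suc pellA.simps pellB.simps Suc by (simp add: algebra_simps power2_eq_square)
  next
    case 2
    show ?case
      unfolding add_Suc pellA.simps pellB.simps Suc by (simp add: algebra_simps power2_eq_square)
  }
qed simp_all

lemma pellB_recurrence: "pellB x (Suc (Suc n)) = 2 * x * pellB x (Suc n) - pellB x n"
  by (simp add: algebra_simps power2_eq_square)

text \<open>Irrational part of multiplication by the inverse x - sqrt(x^2 - 1).\<close>

lemma pellB_pred: "pellB x n = x * pellB x (Suc n) - pellA x (Suc n)"
  by (simp add: algebra_simps power2_eq_square)

text \<open>Pascal's rule. An arbitrary sequence \<open>c\<close> lets one recursion serve both the
  rational and the irrational part.\<close>

lemma binomial_transform_Suc:
  fixes c :: "nat \<Rightarrow> 'a::comm_ring_1"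
  shows "(\<Sum>i\<le>Suc n. of_nat (Suc n choose i) * x ^ (Suc n - i) * c i)
    = x * (\<Sum>i\<le>n. of_nat (n choose i) * x ^ (n - i) * c i)
      + (\<Sum>i\<le>n. of_nat (n choose i) * x ^ (n - i) * c (Suc i))"
proof -
  have "(\<Sum>i\<le>Suc n. of_nat (Suc n choose i) * x ^ (Suc n - i) * c i)
    = x ^ Suc n * c 0 + (\<Sum>i\<le>n. of_nat (n choose Suc i) * x ^ (n - i) * c (Suc i))
      + (\<Sum>i\<le>n. of_nat (n choose i) * x ^ (n - i) * c (Suc i))"
    unfolding sum.atMost_Suc_shift by (simp add: distrib_right sum.distrib)
  moreover have "x * (\<Sum>i\<le>n. of_nat (n choose i) * x ^ (n - i) * c i)
    = (\<Sum>i\<le>Suc n. of_nat (n choose i) * x ^ (Suc n - i) * c i)"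
    by (simp add: sum_distrib_left mult_ac Suc_diff_le binomial_eq_0)
  moreover have "(\<Sum>i\<le>Suc n. of_nat (n choose i) * x ^ (Suc n - i) * c i)
    = x ^ Suc n * c 0 + (\<Sum>i\<le>n. of_nat (n choose Suc i) * x ^ (n - i) * c (Suc i))"
    unfolding sum.atMost_Suc_shift by simp
  ultimately show ?thesis by (simp only:)
qed

lemma pell_binomial:
  fixes x :: "'a::comm_ring_1"
  shows "pellA x n = (\<Sum>i\<le>n. of_nat (n choose i) * x ^ (n - i) *
      (if even i then (x\<^sup>2 - 1) ^ (i div 2) else 0))"
    and "pellB x n = (\<Sum>i\<le>n. of_nat (n choose i) * x ^ (n - i) *
      (if odd i then (x\<^sup>2 - 1) ^ (i div 2) else 0))"
proof -
  \<comment> \<open>The \<open>i\<close>-th power of sqrt(x^2 - 1) is \<open>c i + s i\<close> times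
    that root, so \<open>c\<close> and \<open>s\<close> separate the terms of the binomial
    theorem.\<close>
  define c s where "c i = (if even i then (x\<^sup>2 - 1) ^ (i div 2) else 0)"
    and "s i = (if odd i then (x\<^sup>2 - 1) ^ (i div 2) else 0)" for i :: nat
  have c_Suc: "c (Suc i) = (x\<^sup>2 - 1) * s i" and s_Suc: "s (Suc i) = c i" for i
    by (auto simp: c_def s_def elim!: oddE)
  have "pellA x n = (\<Sum>i\<le>n. of_nat (n choose i) * x ^ (n - i) * c i) \<and>
    pellB x n = (\<Sum>i\<le>n. of_nat (n choose i) * x ^ (n - i) * s i)"
  proof (induction n)
    case 0
    show ?case by (simp add: c_def s_def)
  next
    case (Suc n)
    have "(\<Sum>i\<le>n. of_nat (n choose i) * x ^ (n - i) * c (Suc i)) = (x\<^sup>2 - 1) * pellB x n"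
      using Suc unfolding c_Suc by (simp add: sum_distrib_left mult_ac)
    then show ?case
      using Suc unfolding binomial_transform_Suc s_Suc by simp
  qed
  then show "pellA x n = (\<Sum>i\<le>n. of_nat (n choose i) * x ^ (n - i) *
      (if even i then (x\<^sup>2 - 1) ^ (i div 2) else 0))"
    and "pellB x n = (\<Sum>i\<le>n. of_nat (n choose i) * x ^ (n - i) *
      (if odd i then (x\<^sup>2 - 1) ^ (i div 2) else 0))"
    by (simp_all add: c_def s_def)
qed

section \<open>Chebyshev values at a prime index, modulo that prime\<close>

lemma binomial_transform_prime_cong:
  fixes c :: "nat \<Rightarrow> int"
  assumes "prime q"
  shows "[(\<Sum>i\<le>q. int (q choose i) * x ^ (q - i) * c i) = x ^ q * c 0 + c q] (mod int q)"
proof -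
  have "int q dvd int (q choose i) * x ^ (q - i) * c i" if "i \<in> {..q} - {0, q}" for i
  proof -
    have "q dvd q choose i"
      using that assms by (intro dvd_choose_prime) auto
    then show ?thesis by (simp add: dvd_mult2)
  qed
  then have "[(\<Sum>i\<in>{..q} - {0, q}. int (q choose i) * x ^ (q - i) * c i) = 0] (mod int q)"
    unfolding cong_0_iff by (rule dvd_sum)
  moreover have "(\<Sum>i\<le>q. int (q choose i) * x ^ (q - i) * c i)
    = (\<Sum>i\<in>{0, q}. int (q choose i) * x ^ (q - i) * c i) + (\<Sum>i\<in>{..q} - {0, q}. int (q choose i) * x ^ (q - i) * c i)"
    by (subst sum.subset_diff[of "{0,q}"]) auto
  moreover have "(\<Sum>i\<in>{0, q}. int (q choose i) * x ^ (q - i) * c i) = x ^ q * c 0 + c q"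
    using prime_gt_0_nat[OF assms] by simp
  ultimately show ?thesis
    by (simp add: cong_iff_dvd_diff)
qed

text \<open>Of the binomial expansion only the terms \<open>i = 0\<close> and \<open>i = q\<close>
  survive modulo \<open>q\<close>. The first is rational and reduces to \<open>x\<close> by Fermat;
  the last is irrational since \<open>q\<close> is odd.\<close>

lemma pell_prime_cong:
  fixes x :: int
  assumes "prime q" "odd q"
  shows "[pellA x q = x] (mod int q)" and "[pellB x q = (x\<^sup>2 - 1) ^ ((q - 1) div 2)] (mod int q)"
proof -
  have "[x ^ q = x] (mod int q)"
  proof (cases "int q dvd x")
    case True
    then have "int q dvd x ^ q"
      using prime_gt_0_nat[OF assms(1)] by (metis dvd_power dvd_trans)
    with True show ?thesis by (simp add: cong_iff_dvd_diff)
  next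
    case False
    define y where "y = nat (x mod int q)"
    have y: "[int y = x] (mod int q)" 
      using prime_gt_0_nat[OF assms(1)] by (simp add: y_def)
    then have "\<not> q dvd y"
      using False by (metis cong_dvd_iff cong_sym int_dvd_int_iff)
    then have "[y ^ (q - 1) = 1] (mod q)"
      by (rule fermat_theorem[OF assms(1)])
    then have "[y ^ (q - 1) * y = 1 * y] (mod q)"
      by (rule cong_scalar_right)
    then have "[y ^ q = y] (mod q)"
      using prime_gt_0_nat[OF assms(1)] by (cases q) (auto simp: mult.commute)
    then have "[int y ^ q = int y] (mod int q)"
      using cong_int_iff[of "y ^ q" y q] by simp
    then show ?thesis
      using y by (metis cong_pow cong_sym cong_trans)
  qed
  then show "[pellA x q = x] (mod int q)"
    unfolding pell_binomial(1) 
    using binomial_transform_prime_cong[OF assms(1), of x "\<lambda>i. if even i then (x\<^sup>2 - 1) ^ (i div 2) else 0"] assms(2)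
    by (auto intro: cong_trans)
  have "(q - 1) div 2 = q div 2" using assms(2) by (auto elim: oddE)
  then show "[pellB x q = (x\<^sup>2 - 1) ^ ((q - 1) div 2)] (mod int q)"
    unfolding pell_binomial(2) 
    using binomial_transform_prime_cong[OF assms(1), of x "\<lambda>i. if odd i then (x\<^sup>2 - 1) ^ (i div 2) else 0"] assms(2)
    by auto
qed

text \<open>By the preceding congruences, \<open>q\<close>-th powers act on \<open>x + \<surd>(x\<^sup>2 - 1)\<close> modulo \<open>q\<close> as the identity, as
  conjugation, or by killing the irrational part, depending on the Legendre symbol of
  \<open>x\<^sup>2 - 1\<close>.\<close>

lemma pell_rank:
  fixes x :: int
  assumes "prime q" "odd q"
  shows "\<exists>r\<in>{q - 1, q, q + 1}. int q dvd pellB x r"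
proof -
  let ?L = "Legendre (x\<^sup>2 - 1) (int q)"
  have "q > 2" using assms prime_ge_2_nat[of q] by (cases "q = 2") auto
  then have "[?L = (x\<^sup>2 - 1) ^ ((q - 1) div 2)] (mod int q)"
    using euler_criterion[of q] assms by simp
  then have B: "[pellB x q = ?L] (mod int q)"
    using pell_prime_cong(2)[OF assms, of x] by (meson cong_sym cong_trans)
  have A: "[pellA x q = x] (mod int q)"
    by (rule pell_prime_cong(1)[OF assms])
  have "?L = 0 \<or> ?L = 1 \<or> ?L = -1" by (simp add: Legendre_def)
  then show ?thesis
  proof (elim disjE)
    assume "?L = 0"
    then show ?thesis using B by (simp add: cong_0_iff)
  next
    assume "?L = 1"
    moreover have "pellB x (q - 1) = x * pellB x q - pellA x q"
      using pellB_pred[of x "q - 1"] \<open>q > 2\<close> by (simp del: pellB.simps pellA.simps)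
    ultimately have "[pellB x (q - 1) = x * 1 - x] (mod int q)"
      using A B by (metis cong_diff cong_scalar_left)
    then show ?thesis by (simp add: cong_0_iff)
  next
    assume "?L = -1"
    moreover have "pellB x (q + 1) = pellA x q + x * pellB x q"
      by simp
    ultimately have "[pellB x (q + 1) = x + x * (-1)] (mod int q)"
      using A B by (metis cong_add cong_scalar_left)
    then have "int q dvd pellB x (q + 1)" by (simp add: cong_0_iff)
    then show ?thesis by blast
  qed
qed

section \<open>Prime divisors and the indices at which they occur\<close>

lemma pellB_dvd_mult: "(d::int) dvd pellB x m \<Longrightarrow> d dvd pellB x (m * n)"
  by (induction n) (auto simp: pell_add)

text \<open>By Bezout, coprime indices have multiples differing by 1. If \<open>q\<close> divides
  \<open>pellB\<close> at both, the addition formula makes it divide \<open>pellA\<close> at the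
  smaller one too, against norm 1.\<close>

lemma pellB_coprime:
  fixes x :: int
  assumes "prime q" "int q dvd pellB x m" "int q dvd pellB x n" "m > 0"
  shows "\<not> coprime m n"
proof
  assume "coprime m n"
  then obtain u v where uv: "m * u = n * v + 1"
    using bezout_nat[of m n] \<open>m > 0\<close> by auto
  have 1: "int q dvd pellB x (m * u)" and 2: "int q dvd pellB x (n * v)"
    using assms by (auto intro: pellB_dvd_mult)
  have "int q dvd pellA x (n * v)"
    using 1 2 unfolding uv pell_add by (simp add: dvd_add_left_iff)
  with 2 have "int q dvd (pellA x (n * v))\<^sup>2 - (x\<^sup>2 - 1) * (pellB x (n * v))\<^sup>2"
    by (simp add: power2_eq_square)
  then show False
    using assms(1) by (simp add: pell_norm prime_nat_iff)
qed


text \<open>Oddness rules out 2 as a prime divisor, and the value at 0 shows that no prime divides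
  the constant term of the sieve polynomial.\<close>

lemma pellB_odd_index:
  fixes x :: int
  shows "odd (pellB x (Suc (2 * n)))" and "pellB (0::int) (Suc (2 * n)) = (-1) ^ n"
proof (induction n)
  case (Suc n)
  have "Suc (2 * Suc n) = Suc (Suc (Suc (2 * n)))" by simp
  then have *: "pellB y (Suc (2 * Suc n)) = 2 * y * pellB y (Suc (Suc (2 * n))) - pellB y (Suc (2 * n))" for y :: int
    by (metis pellB_recurrence)
  {
    case 1 show ?case unfolding * using Suc(1) by (simp del: pellB.simps)
  next
    case 2 show ?case unfolding * using Suc(2) by (simp del: pellB.simps)
  }
qed simp_all

lemma pellB_pos:
  fixes x :: int
  assumes "x \<ge> 1" "n > 0"
  shows "pellB x n > 0"
proof -
  have "pellA x n > 0 \<and> pellB x n \<ge> 0" for n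
  proof (induction n)
    case (Suc n)
    have "x\<^sup>2 - 1 \<ge> 0" using assms by simp
    with Suc assms show ?case by (auto intro: add_pos_nonneg add_nonneg_nonneg)
  qed simp
  then show ?thesis
    using assms by (cases n) (auto intro!: add_pos_nonneg)
qed

text \<open>The prime \<open>q\<close> also divides \<open>pellB\<close> at one of the indices
  \<open>q - 1\<close>, \<open>q\<close>, \<open>q + 1\<close>. That index is not coprime to
  \<open>p\<close>, hence is a multiple of \<open>p\<close>.\<close>

lemma pellB_prime_divisor:
  fixes x :: int
  assumes "prime p" "odd p" "prime q" "int q dvd pellB x p"
  shows "q = p \<or> [int q = 1] (mod int p) \<or> [int q = -1] (mod int p)"
proof -
  obtain j where "p = Suc (2 * j)" using assms(2) by (auto elim: oddE)
  then have "odd (pellB x p)" using pellB_odd_index(1) by blast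
  then have "odd q" using assms(4) by (metis dvd_trans even_of_nat)
  then obtain r where r: "r \<in> {q - 1, q, q + 1}" "int q dvd pellB x r"
    using pell_rank assms(3) by blast
  have "\<not> coprime p r"
    using pellB_coprime assms r prime_gt_0_nat by blast
  then have "p dvd r" using assms(1) prime_imp_coprime by blast
  then consider "p dvd q - 1" | "p dvd q" | "p dvd q + 1" using r by auto
  then show ?thesis
  proof cases
    case 1
    then have "int p dvd int q - 1"
      using prime_gt_0_nat[OF assms(3)] by (metis Suc_leI int_dvd_int_iff of_nat_1 of_nat_diff One_nat_def)
    then show ?thesis by (simp add: cong_iff_dvd_diff)
  next
    case 2
    then have "p = q" using assms primes_dvd_imp_eq by blast
    then show ?thesis by simp
  next
    case 3
    then have "int p dvd int q + 1" by (metis int_dvd_int_iff of_nat_1 of_nat_add)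
    then show ?thesis by (simp add: cong_iff_dvd_diff)
  qed
qed

text \<open>Otherwise the squares would be closed under subtracting 1, so every residue would be a square.\<close>

lemma exists_square_minus_one_nonresidue:
  assumes "prime p" "odd p"
  shows "\<exists>r::int. \<not> QuadRes (int p) (r\<^sup>2 - 1)"
proof (rule ccontr)
  assume "\<not> ?thesis"
  then have *: "QuadRes (int p) (r\<^sup>2 - 1)" for r by blast
  have neg: "QuadRes (int p) (- int n)" for n
  proof (induction n)
    case 0 show ?case unfolding QuadRes_def by (rule exI[of _ 0]) simp
  next
    case (Suc n)
    then obtain y where y: "[y\<^sup>2 = - int n] (mod int p)" unfolding QuadRes_def by blast
    obtain w where "[w\<^sup>2 = y\<^sup>2 - 1] (mod int p)" using * unfolding QuadRes_def by blast
    also have "[y\<^sup>2 - 1 = - int n - 1] (mod int p)" using y by (intro cong_diff) auto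
    also have "- int n - 1 = - int (Suc n)" by simp
    finally have "[w\<^sup>2 = - int (Suc n)] (mod int p)" .
    then show ?case unfolding QuadRes_def by blast
  qed
  have p2: "p > 2" using assms prime_ge_2_nat[of p] by (cases "p = 2") auto
  \<comment> \<open>As the numbers \<open>- int n\<close> cover all residues, squaring would be
    surjective on residues, hence injective; but 1 and \<open>p - 1\<close> have equal
    squares.\<close>
  let ?f = "\<lambda>y. y\<^sup>2 mod int p" and ?A = "{0..<int p}"
  have "?A \<subseteq> ?f ` ?A"
  proof
    fix a assume a: "a \<in> ?A"
    obtain y where "[y\<^sup>2 = - int (nat (int p - a))] (mod int p)"
      using neg unfolding QuadRes_def by blast
    then have "[y\<^sup>2 = a - int p] (mod int p)" using a by simp
    then have "int p dvd y\<^sup>2 - a + int p"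
      by (simp add: cong_iff_dvd_diff algebra_simps)
    then have "int p dvd y\<^sup>2 - a" by (simp add: dvd_add_left_iff)
    then have "y\<^sup>2 mod int p = a mod int p" by (simp add: mod_eq_dvd_iff)
    then have "?f (y mod int p) = a" using a by (simp add: power_mod)
    moreover have "y mod int p \<in> ?A" using p2 by simp
    ultimately show "a \<in> ?f ` ?A" by blast
  qed
  then have "card (?f ` ?A) = card ?A"
    by (intro antisym card_image_le card_mono) auto
  then have "inj_on ?f ?A"
    by (intro eq_card_imp_inj_on) auto
  moreover have "?f 1 = ?f (int p - 1)"
  proof -
    have "(int p - 1)\<^sup>2 = 1 + int p * (int p - 2)" by (simp add: power2_eq_square algebra_simps)
    then show ?thesis by simp
  qed
  moreover have "1 \<in> ?A" "int p - 1 \<in> ?A" using p2 by auto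
  ultimately have "1 = int p - 1" by (rule inj_onD)
  then show False using p2 by simp
qed

text \<open>Euler's criterion for the power of \<open>x\<^sup>2 - 1\<close> to which
  \<open>pellB x p\<close> reduces; only the class of \<open>x\<close> modulo \<open>p\<close>
  matters.\<close>

lemma pellB_cong_minus_one:
  assumes "prime p" "odd p"
  obtains r where "\<And>x. [x = r] (mod int p) \<Longrightarrow> [pellB x p = -1] (mod int p)"
proof -
  obtain r where r: "\<not> QuadRes (int p) (r\<^sup>2 - 1)" 
    using exists_square_minus_one_nonresidue assms by blast
  have "\<not> [r\<^sup>2 - 1 = 0] (mod int p)"
  proof
    assume "[r\<^sup>2 - 1 = 0] (mod int p)"
    then have "QuadRes (int p) (r\<^sup>2 - 1)"
      unfolding QuadRes_def by (intro exI[of _ 0]) (simp add: cong_sym_eq)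
    with r show False by blast
  qed
  then have L: "Legendre (r\<^sup>2 - 1) (int p) = -1" using r by (simp add: Legendre_def)
  have p2: "p > 2" using assms prime_ge_2_nat[of p] by (cases "p = 2") auto
  show ?thesis
  proof (rule that)
    fix x assume "[x = r] (mod int p)"
    then have "[(x\<^sup>2 - 1) ^ ((p - 1) div 2) = (r\<^sup>2 - 1) ^ ((p - 1) div 2)] (mod int p)"
      by (intro cong_pow cong_diff) auto
    moreover have "[-1 = (r\<^sup>2 - 1) ^ ((p - 1) div 2)] (mod int p)"
      using euler_criterion[of p "r\<^sup>2 - 1"] assms p2 L by simp
    ultimately show "[pellB x p = -1] (mod int p)"
      using pell_prime_cong(2)[OF assms, of x] by (meson cong_sym cong_trans)
  qed
qed

lemma cong_one_of_prime_divisors: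
  fixes m n :: nat
  assumes "n > 0" "\<And>q. prime q \<Longrightarrow> q dvd n \<Longrightarrow> [q = 1] (mod m)"
  shows "[n = 1] (mod m)"
proof -
  have "[prod_mset M = 1] (mod m)" if "\<And>q. q \<in># M \<Longrightarrow> [q = 1] (mod m)" for M
    using that
  proof (induction M)
    case (add q M)
    then have "[q * prod_mset M = 1 * 1] (mod m)" by (intro cong_mult) auto
    then show ?case by simp
  qed simp
  from this[of "prime_factorization n"] show ?thesis
    using assms by (simp add: in_prime_factors_iff prod_mset_prime_factorization_nat)
qed

text \<open>The value is -1 modulo \<open>p\<close>, so \<open>p\<close> does not divide it. If all
  its prime factors were 1 modulo \<open>p\<close>, so would be the value itself, impossible for
  \<open>p > 2\<close>.\<close>

lemma pellB_has_divisor: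
  fixes x :: int
  assumes "prime p" "odd p" "x \<ge> 1" "[pellB x p = -1] (mod int p)"
  shows "\<exists>q. prime q \<and> [int q = -1] (mod int p) \<and> int q dvd pellB x p"
proof (rule ccontr)
  assume neg: "\<not> ?thesis"
  define n where "n = nat (pellB x p)"
  have n: "n > 0" "int n = pellB x p" 
    using pellB_pos[of x p] assms prime_gt_0_nat by (auto simp: n_def)
  have p2: "p > 2" using assms prime_ge_2_nat[of p] by (cases "p = 2") auto
  have "[n = 1] (mod p)"
  proof (rule cong_one_of_prime_divisors[OF n(1)])
    fix q assume q: "prime q" "q dvd n"
    then have dvd: "int q dvd pellB x p" using n(2) by (metis int_dvd_int_iff)
    have "q \<noteq> p"
    proof
      assume "q = p"
      then have "int p dvd -1" using dvd assms(4) cong_dvd_iff by blast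
      then show False using p2 by simp
    qed
    then have "[int q = int 1] (mod int p)"
      using pellB_prime_divisor[of p q x] assms(1,2) q(1) dvd neg by auto
    then show "[q = 1] (mod p)" by (simp only: cong_int_iff)
  qed
  then have "[int n = 1] (mod int p)" using cong_int_iff[of n 1 p] by simp
  then have "[1 = -1] (mod int p)" using assms(4) n(2) by (metis cong_sym cong_trans)
  then have "int p dvd 2" by (simp add: cong_iff_dvd_diff)
  then show False using p2 zdvd_imp_le by fastforce
qed

section \<open>Primorials and reciprocal sums\<close>

lemma prod_primes_dvd:
  fixes n :: nat
  assumes "finite A" "\<And>q. q \<in> A \<Longrightarrow> prime q" "\<And>q. q \<in> A \<Longrightarrow> q dvd n"
  shows "\<Prod>A dvd n"
  using assms
proof (induction A rule: finite_induct)
  case (insert q A)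
  have "coprime q r" if "r \<in> A" for r
    using insert that by (intro primes_coprime) auto
  then have "coprime q (\<Prod>A)" by (intro prod_coprime_right)
  with insert show ?case by (simp add: divides_mult)
qed simp

text \<open>The two central coefficients of an odd row are equal, and their sum is at most the row
  sum.\<close>

lemma central_binomial_le: "(2 * m + 1) choose m \<le> 4 ^ m"
proof -
  have "2 * ((2 * m + 1) choose m) = (2*m+1 choose m) + (2*m+1 choose (m+1))"
    using binomial_symmetric[of m "2*m+1"] by simp
  also have "\<dots> = (\<Sum>i\<in>{m,m+1}. (2*m+1 choose i))" by simp
  also have "\<dots> \<le> (\<Sum>i\<le>2*m+1. (2*m+1 choose i))"
    by (rule sum_mono2) auto
  also have "\<dots> = 2 ^ (2*m+1)" by (rule choose_row_sum)
  also have "\<dots> = 2 * 4 ^ m" by (simp add: power_mult)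
  finally show ?thesis by simp
qed

lemma finite_primes_le [simp]: "finite {q::nat. prime q \<and> q \<le> n}"
  by (rule finite_subset[of _ "{..n}"]) auto

text \<open>Erdos' induction: an even \<open>n > 2\<close> adds no prime, and for
  \<open>n = 2 * m + 1\<close> the primes above \<open>m + 1\<close> all divide a central binomial
  coefficient.\<close>

lemma primorial_le: "\<Prod>{q::nat. prime q \<and> q \<le> n} \<le> 4 ^ n"
proof (induction n rule: less_induct)
  case (less n)
  consider "n \<le> 1" | "n = 2" | "n > 2" "even n" | m where "n = 2 * m + 1" "m > 0"
  proof (cases "even n")
    case False
    then obtain m where "n = 2 * m + 1" by (auto elim: oddE)
    then show ?thesis using that by (cases "m = 0") auto
  next
    case True
    then show ?thesis using that by linarith
  qed
  then show ?case
  proof cases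
    case 1
    have "\<not> prime q" if "q \<le> n" for q
      using that 1 prime_ge_2_nat[of q] by auto
    then have "{q::nat. prime q \<and> q \<le> n} = {}" by blast
    then show ?thesis by (simp only: prod.empty) simp
  next
    case 2
    have "q = 2" if "prime q" "q \<le> 2" for q :: nat
      using that prime_ge_2_nat[of q] by simp
    then have "{q::nat. prime q \<and> q \<le> 2} = {2}" 
      using two_is_prime_nat by blast
    then show ?thesis unfolding 2 by (simp only:) simp
  next
    case 3
    then have "\<not> prime n" using prime_odd_nat by blast
    then have "{q::nat. prime q \<and> q \<le> n} = {q. prime q \<and> q \<le> n - 1}"
      using 3 by (auto simp: le_less) 
    then have "\<Prod>{q::nat. prime q \<and> q \<le> n} \<le> 4 ^ (n - 1)" using less[of "n - 1"] 3 by simp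
    also have "\<dots> \<le> 4 ^ n" by (rule power_increasing) auto
    finally show ?thesis .
  next
    case 4
    define A where "A = {q::nat. prime q \<and> m + 1 < q \<and> q \<le> n}"
    have fin: "finite A" unfolding A_def by (rule finite_subset[OF _ finite_primes_le[of n]]) auto
    have "q dvd (2 * m + 1) choose m" if "q \<in> A" for q
    proof -
      have q: "prime q" "m + 1 < q" "q \<le> 2 * m + 1" using that 4 by (auto simp: A_def)
      have "fact m * fact (2 * m + 1 - m) * ((2 * m + 1) choose m) = (fact (2 * m + 1) :: nat)"
        by (rule binomial_fact_lemma) simp
      moreover have "q dvd (fact (2 * m + 1) :: nat)"
        using q by (simp add: prime_dvd_fact_iff del: fact_Suc)
      moreover have "\<not> q dvd (fact m :: nat)" "\<not> q dvd (fact (2 * m + 1 - m) :: nat)"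
        using q by (simp_all add: prime_dvd_fact_iff del: fact_Suc)
      ultimately show ?thesis using q(1) by (metis prime_dvd_mult_iff)
    qed
    then have "\<Prod>A dvd (2 * m + 1) choose m"
      using fin by (intro prod_primes_dvd) (auto simp: A_def)
    then have "\<Prod>A \<le> (2 * m + 1) choose m" by (rule dvd_imp_le) simp
    then have A: "\<Prod>A \<le> 4 ^ m" using central_binomial_le order_trans by blast
    have "{q::nat. prime q \<and> q \<le> n} = {q. prime q \<and> q \<le> m + 1} \<union> A"
      using 4 by (auto simp: A_def)
    then have "\<Prod>{q::nat. prime q \<and> q \<le> n} = \<Prod>{q. prime q \<and> q \<le> m + 1} * \<Prod>A"
      using fin by (simp only:) (rule prod.union_disjoint, auto simp: A_def)
    also have "\<dots> \<le> 4 ^ (m + 1) * 4 ^ m"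
      using 4 A by (intro mult_le_mono less) auto
    also have "\<dots> = 4 ^ n" by (simp add: 4 flip: power_add)
    finally show ?thesis .
  qed
qed

lemma prod_primes_le:
  assumes "\<And>q. q \<in> A \<Longrightarrow> prime q \<and> q \<le> n"
  shows "\<Prod>A \<le> 4 ^ n"
proof -
  have "\<Prod>A dvd \<Prod>{q::nat. prime q \<and> q \<le> n}"
    using assms by (intro prod_dvd_prod_subset) auto
  then have "\<Prod>A \<le> \<Prod>{q::nat. prime q \<and> q \<le> n}"
    by (rule dvd_imp_le) (auto intro!: prod_pos simp: prime_gt_0_nat)
  then show ?thesis using primorial_le order_trans by blast
qed

text \<open>Compares the lower bound \<open>z ^ card A\<close> for the product of \<open>A\<close>
  with the primorial bound \<open>4 ^ n\<close>.\<close>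

lemma card_primes_ln_le:
  assumes "\<And>q. q \<in> A \<Longrightarrow> prime q \<and> z < q \<and> q \<le> n" "z > 0"
  shows "real (card A) * ln (real z) \<le> real n * ln 4"
proof -
  have "finite A" by (rule finite_subset[of _ "{..n}"]) (use assms in auto)
  have "z ^ card A = (\<Prod>q\<in>A. z)" by simp
  also have "\<dots> \<le> \<Prod>A" using assms by (intro prod_mono) (auto simp: less_imp_le)
  also have "\<dots> \<le> 4 ^ n" using assms by (intro prod_primes_le) auto
  finally have "ln (real (z ^ card A)) \<le> ln (real (4 ^ n))"
    using assms(2) by (subst ln_le_cancel_iff) (auto simp del: of_nat_power)
  then show ?thesis using assms(2) by (simp add: ln_realpow)
qed

text \<open>Split at \<open>b * k\<close>. Below it Chebyshev's bound limits the number of primes,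
  each with reciprocal at most \<open>1 / z\<close>; above it there are at most \<open>k\<close>
  terms, each at most \<open>1 / (b * k)\<close>.\<close>

lemma sum_inverse_primes_le:
  fixes k b z :: nat
  assumes "finite A" "\<And>q. q \<in> A \<Longrightarrow> prime q \<and> z < q" "card A \<le> k" "z > 1" "b > 0" "k > 0"
  shows "(\<Sum>q\<in>A. 1 / real q) \<le> real (b * k) * ln 4 / (real z * ln (real z)) + 1 / real b"
proof -
  define A1 where "A1 = {q\<in>A. q \<le> b * k}"
  define A2 where "A2 = {q\<in>A. q > b * k}"
  have "ln (real z) > 0" using assms by simp
  have "A = A1 \<union> A2" by (auto simp: A1_def A2_def)
  then have "(\<Sum>q\<in>A. 1 / real q) = (\<Sum>q\<in>A1. 1 / real q) + (\<Sum>q\<in>A2. 1 / real q)"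
    using assms(1) by (simp only:) (rule sum.union_disjoint, auto simp: A1_def A2_def)
  also have "\<dots> \<le> real (b * k) * ln 4 / ln (real z) * (1 / real z) + real k * (1 / real (b * k))"
  proof (rule add_mono)
    have "(\<Sum>q\<in>A1. 1 / real q) \<le> real (card A1) * (1 / real z)"
  proof (rule sum_bounded_above)
    fix q assume "q \<in> A1"
    then have "z < q" using assms(2) by (simp add: A1_def)
    then show "1 / real q \<le> 1 / real z" using assms(4) by (simp add: frac_le)
  qed
  also have "real (card A1) * (1 / real z) \<le> real (b * k) * ln 4 / ln (real z) * (1 / real z)"
    using card_primes_ln_le[of A1 z "b * k"] assms \<open>ln (real z) > 0\<close>
    by (intro mult_right_mono) (auto simp: A1_def pos_le_divide_eq)
  finally show "(\<Sum>q\<in>A1. 1 / real q) \<le> real (b * k) * ln 4 / ln (real z) * (1 / real z)" .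
  have "(\<Sum>q\<in>A2. 1 / real q) \<le> real (card A2) * (1 / real (b * k))"
  proof (rule sum_bounded_above)
    fix q assume "q \<in> A2"
    then have "b * k < q" by (simp add: A2_def)
    then show "1 / real q \<le> 1 / real (b * k)"
      using assms by (intro frac_le) (simp_all del: of_nat_mult)
  qed
    also have "real (card A2) * (1 / real (b * k)) \<le> real k * (1 / real (b * k))"
      using assms card_mono[of A A2] by (intro mult_right_mono) (auto simp: A2_def)
    finally show "(\<Sum>q\<in>A2. 1 / real q) \<le> real k * (1 / real (b * k))" .
  qed
  also have "\<dots> = real (b * k) * ln 4 / (real z * ln (real z)) + 1 / real b"
    using assms by (simp add: field_simps)
  finally show ?thesis .
qed

section \<open>A sieve for prime divisors of polynomial values\<close>

text \<open>Lagrange's bound by splitting off linear factors. A point \<open>x\<close> where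
  \<open>f\<close> does not vanish modulo \<open>q\<close> witnesses that \<open>f\<close> is
  nonzero there, and the quotient inherits the same witness.\<close>

lemma card_roots_mod_prime:
  fixes f :: "int poly"
  assumes "prime q" "\<not> int q dvd poly f x"
  shows "card {r\<in>{0..<int q}. int q dvd poly f r} \<le> degree f"
  using assms(2)
proof (induction "degree f" arbitrary: f)
  case 0
  then obtain c where "f = [:c:]" by (metis degree_eq_zeroE)
  with 0 show ?case by simp
next
  case (Suc n)
  show ?case
  proof (cases "{r\<in>{0..<int q}. int q dvd poly f r} = {}")
    case False
    then obtain r where r: "r \<in> {0..<int q}" "int q dvd poly f r" by blast
    define g where "g = synthetic_div f r"
    have f: "poly f y = (y - r) * poly g y + poly f r" for y
      using arg_cong[OF synthetic_div_correct'[of r f], of "\<lambda>h. poly h y"] by (simp add: g_def algebra_simps)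
    have dvd: "int q dvd poly f y \<longleftrightarrow> int q dvd y - r \<or> int q dvd poly g y" for y
      using r(2) assms(1) by (subst f) (simp add: dvd_add_left_iff prime_dvd_mult_iff)
    have n: "n = degree g" using Suc(2) by (simp add: g_def degree_synthetic_div flip: Suc(2))
    have "\<not> int q dvd poly g x" using Suc(3) dvd by blast
    then have IH: "card {y\<in>{0..<int q}. int q dvd poly g y} \<le> degree g" 
      using Suc(1) n by blast
    have "y = r" if "y \<in> {0..<int q}" "int q dvd y - r" for y
      using that r(1) by (metis atLeastLessThan_iff mod_eq_dvd_iff mod_pos_pos_trivial)
    then have "{y\<in>{0..<int q}. int q dvd poly f y} \<subseteq> insert r {y\<in>{0..<int q}. int q dvd poly g y}"
      using dvd by blast
    then have "card {y\<in>{0..<int q}. int q dvd poly f y} \<le> card (insert r {y\<in>{0..<int q}. int q dvd poly g y})"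
      by (rule card_mono[rotated]) (simp add: finite_Collect_conjI del: atLeastLessThan_iff)
    also have "\<dots> \<le> Suc (card {y\<in>{0..<int q}. int q dvd poly g y})"
      by (simp add: card_insert_if finite_Collect_conjI del: atLeastLessThan_iff)
    finally show ?thesis using IH n Suc(2) by linarith
  next
    case True
    then show ?thesis by (simp only: card.empty)
  qed
qed

lemma cong_poly:
  fixes f :: "int poly"
  assumes "[x = y] (mod m)"
  shows "[poly f x = poly f y] (mod m)"
  by (induction f) (auto intro!: cong_add cong_mult assms)

text \<open>As \<open>a\<close> is invertible modulo \<open>q\<close>, an index \<open>j\<close> is
  determined by its block \<open>j div q\<close> and the residue of its term, which is a root of
  \<open>f\<close>.\<close>

lemma card_progression_roots_mod_prime:
  fixes f :: "int poly" and a b :: int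
  assumes "prime q" "\<not> int q dvd poly f x" "\<not> int q dvd a"
  shows "card {j. j < n \<and> int q dvd poly f (b + a * int j)} \<le> (n div q + 1) * degree f"
proof -
  let ?J = "{j. j < n \<and> int q dvd poly f (b + a * int j)}"
    and ?R = "{r\<in>{0..<int q}. int q dvd poly f r}"
    and ?h = "\<lambda>j. (j div q, (b + a * int j) mod int q)"
  have q: "q > 0" using assms(1) prime_gt_0_nat by blast
  have "inj_on ?h ?J"
  proof (rule inj_onI)
    fix i j assume "?h i = ?h j"
    then have "i div q = j div q" and "(b + a * int i) mod int q = (b + a * int j) mod int q" by auto
    then have "int q dvd a * (int i - int j)" by (simp add: mod_eq_dvd_iff algebra_simps)
    then have "int q dvd int i - int j" using assms by (simp add: prime_dvd_mult_iff)
    then have "int i mod int q = int j mod int q" by (simp only: mod_eq_dvd_iff)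
    then have "i mod q = j mod q" by (metis of_nat_eq_iff zmod_int)
    with \<open>i div q = j div q\<close> show "i = j" by (metis div_mult_mod_eq)
  qed
  moreover have "?h ` ?J \<subseteq> {..n div q} \<times> ?R"
  proof
    fix y assume "y \<in> ?h ` ?J"
    then obtain j where j: "j \<in> ?J" "y = ?h j" by blast
    have "[poly f ((b + a * int j) mod int q) = poly f (b + a * int j)] (mod int q)"
      by (rule cong_poly) simp
    then have "int q dvd poly f ((b + a * int j) mod int q)" using j cong_dvd_iff by blast
    then show "y \<in> {..n div q} \<times> ?R" using j q by (auto intro: div_le_mono)
  qed
  ultimately have "card ?J \<le> card ({..n div q} \<times> ?R)"
    by (intro card_inj_on_le finite_cartesian_product finite_subset[of ?R "{0..<int q}"]) auto
  also have "\<dots> = (n div q + 1) * card ?R" by (simp add: card_cartesian_product)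
  also have "\<dots> \<le> (n div q + 1) * degree f" using card_roots_mod_prime assms by (intro mult_le_mono2) blast
  finally show ?thesis .
qed

lemma abs_poly_le:
  fixes f :: "int poly"
  assumes "x \<ge> 1"
  shows "\<bar>poly f x\<bar> \<le> (\<Sum>i\<le>degree f. \<bar>coeff f i\<bar>) * x ^ degree f"
proof -
  have "\<bar>poly f x\<bar> \<le> (\<Sum>i\<le>degree f. \<bar>coeff f i * x ^ i\<bar>)"
    unfolding poly_altdef by (rule sum_abs)
  also have "\<dots> \<le> (\<Sum>i\<le>degree f. \<bar>coeff f i\<bar> * x ^ degree f)"
    using assms by (intro sum_mono) (auto simp: abs_mult power_increasing intro!: mult_left_mono)
  finally show ?thesis by (simp add: sum_distrib_right)
qed

text \<open>If \<open>Q\<close> had fewer than \<open>k\<close> elements below \<open>2\<^sup>k\<close>, consider \<open>J = O(k)\<close> terms of a progression of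
  multiples of \<open>M = \<Prod>{q \<in> Q. q \<le> z}\<close> with \<open>z\<close> a small multiple of \<open>k\<close>, so that \<open>M \<le> 4\<^sup>z\<close> keeps the
  values of \<open>F\<close> below \<open>2\<^sup>k\<close>. No \<open>q \<le> z\<close> divides these values, as \<open>F n \<equiv> F 0\<close> modulo
  \<open>q\<close>. Each of the fewer than \<open>k\<close> larger \<open>q\<close> divides at most \<open>(J / q + 1) deg F\<close> of them, and by
  Chebyshev's bound the sum of their reciprocals is small, so some value has no divisor in \<open>Q\<close>.\<close>

lemma eventually_card_prime_divisors_ge:
  fixes F :: "int poly" and Q :: "nat set" and m :: nat and r :: int
  assumes "m > 0"
    and Q: "\<And>q. q \<in> Q \<Longrightarrow> prime q" "\<And>q. q \<in> Q \<Longrightarrow> \<not> q dvd m"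
      "\<And>q. q \<in> Q \<Longrightarrow> \<not> int q dvd poly F 0"
    and F: "\<And>n. n \<ge> 1 \<Longrightarrow> [n = r] (mod int m) \<Longrightarrow> poly F n \<noteq> 0"
      "\<And>n. n \<ge> 1 \<Longrightarrow> [n = r] (mod int m) \<Longrightarrow> \<exists>q\<in>Q. int q dvd poly F n"
  shows "\<forall>\<^sub>F k in sequentially. k \<le> card {q\<in>Q. q < 2 ^ k}"
proof -
  define d where "d = degree F"
  \<comment> \<open>Positive even when \<open>F\<close> is constant, so that it may stand in
    denominators.\<close>
  define D where "D = d + 1"
  define H where "H = (\<Sum>i\<le>d. \<bar>coeff F i\<bar>)"
  have "D > 0" and "m > 0" using assms by (auto simp: D_def)
  \<comment> \<open>Half of the exponent \<open>k\<close> is reserved for the coefficients of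
    \<open>F\<close> and the length of the progression; the other half pays for
    \<open>(4 ^ z) ^ d\<close>.\<close>
  have "\<forall>\<^sub>F k in sequentially.
      (real_of_int H + 1) * (4 * real m * real D * real k + real m) ^ d < 2 powr (real k / 2)"
  proof -
    define A c where "A = 4 * real m * real D" and "c = real_of_int H + 1"
    have "A > 0" "c > 0" using \<open>D > 0\<close> \<open>m > 0\<close> by (auto simp: A_def c_def H_def sum_nonneg intro!: add_nonneg_pos)
    then have "\<forall>\<^sub>F k in sequentially. c * (A * real k + real m) ^ d < 2 powr (real k / 2)"
      by real_asymp
    then show ?thesis by (simp add: A_def c_def)
  qed
  \<comment> \<open>Together with \<open>k < 8 * D * z\<close>, this constant makes the Chebyshev
    part of the reciprocal sum at most \<open>1 / (4 * D)\<close>.\<close>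
  moreover have "\<forall>\<^sub>F k in sequentially. 128 * real D ^ 3 * ln 4 \<le> ln (real (k div (4 * D)))"
  proof -
    have "filterlim (\<lambda>k. k div (4 * D)) at_top sequentially"
      using \<open>D > 0\<close> by (intro filterlim_at_top_div_const_nat) auto
    moreover have "\<forall>\<^sub>F z in sequentially. 128 * real D ^ 3 * ln 4 \<le> ln (real z)"
      by real_asymp
    ultimately show ?thesis by (rule eventually_compose_filterlim[rotated])
  qed
  moreover have "\<forall>\<^sub>F k in sequentially. k \<ge> 8 * D" by (rule eventually_ge_at_top)
  ultimately show ?thesis
  proof eventually_elim
    case (elim k)
    \<comment> \<open>The factor 4 gives \<open>(4 ^ z) ^ d \<le> 2 powr (k / 2)\<close>, while
      \<open>z\<close> stays proportional to \<open>k\<close>.\<close>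
    define z where "z = k div (4 * D)"
    have z: "z > 1" "4 * D * z \<le> k" "k < 8 * D * z"
    proof -
      have "8 * D div (4 * D) \<le> z" unfolding z_def using elim(3) by (intro div_le_mono)
      then show "z > 1" using \<open>D > 0\<close> by simp
      show "4 * D * z \<le> k" by (simp add: z_def)
      have "k < 4 * D * z + 4 * D" using \<open>D > 0\<close> unfolding z_def
        by (metis add.commute dividend_less_times_div mult_pos_pos zero_less_numeral)
      also have "\<dots> \<le> 8 * D * z" using \<open>z > 1\<close> by (cases z) auto
      finally show "k < 8 * D * z" .
    qed
    have "k > 0" using elim(3) \<open>D > 0\<close> by simp
    show "k \<le> card {q\<in>Q. q < 2 ^ k}"
    proof (rule ccontr)
      assume few: "\<not> ?thesis"
      \<comment> \<open>With this length the final count is at most \<open>J / 2\<close> from the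
        reciprocals plus \<open>D * k = J / 4\<close> from the rounding terms, less than
        \<open>J\<close>.\<close>
      define J where "J = 4 * D * k"
      have "J > 0" using \<open>k > 0\<close> \<open>D > 0\<close> by (simp add: J_def)
      define M where "M = \<Prod>{q\<in>Q. q \<le> z}"
      have fin: "finite {q\<in>Q. q \<le> z}" by (rule finite_subset[of _ "{..z}"]) auto
      have M_le: "M \<le> 4 ^ z" unfolding M_def using Q by (intro prod_primes_le) auto
      then have M_le': "int M \<le> 4 ^ z" by (metis of_nat_le_iff of_nat_numeral of_nat_power)
      have "M > 0" unfolding M_def using Q prime_gt_0_nat by (intro prod_pos) auto
      have "coprime M m" unfolding M_def
        using Q by (intro prod_coprime_left) (auto intro: prime_imp_coprime)
      then have "coprime (int M) (int m)" by simp
      then obtain x where x: "[int M * x = 1] (mod int m)" using cong_solve_coprime_int by blast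
      \<comment> \<open>Chosen so that \<open>M * t\<close> lies in the class of \<open>r\<close>
        modulo \<open>m\<close>; adding \<open>m\<close> makes \<open>t\<close> positive. Steps of
        \<open>M * m\<close> preserve this class and divisibility by \<open>M\<close>.\<close>
      define t where "t = (x * r) mod int m + int m"
      have t: "1 \<le> t" "t < 2 * int m" using \<open>m > 0\<close> by (auto simp: t_def add_nonneg_pos int_one_le_iff_zero_less)
      define n where "n j = int M * t + int M * int m * int j" for j
      have n_ge: "n j \<ge> 1" for j
      proof -
        have "int M * t \<ge> 1" using \<open>M > 0\<close> t by (simp add: int_one_le_iff_zero_less)
        then show ?thesis by (simp add: n_def add_increasing2)
      qed
      have n_cong: "[n j = r] (mod int m)" for j
      proof -
        have "[t = x * r + 0] (mod int m)"
          unfolding t_def by (intro cong_add) (auto simp: cong_0_iff)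
        then have "[n j = int M * (x * r + 0) + 0] (mod int m)"
          unfolding n_def by (intro cong_add cong_mult) (auto simp: cong_0_iff)
        also have "int M * (x * r + 0) + 0 = int M * (x * r)" by simp
        also have "int M * (x * r) = int M * x * r" by simp
        also have "[int M * x * r = 1 * r] (mod int m)" using x by (rule cong_scalar_right)
        finally show ?thesis by simp
      qed
      have small: "\<bar>poly F (n j)\<bar> < 2 ^ k" if "j < J" for j
      proof -
        have "t + int m * int j \<le> 2 * int m + int m * (int J - 1)"
          using t that by (intro add_mono mult_left_mono) auto
        also have "\<dots> = int m * (int J + 1)" by (simp add: algebra_simps)
        finally have "int M * (t + int m * int j) \<le> 4 ^ z * (int m * (int J + 1))"
          using M_le' t by (intro mult_mono) auto
        then have n_le: "n j \<le> 4 ^ z * (int m * (int J + 1))"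
          by (simp add: n_def algebra_simps)
        have "\<bar>poly F (n j)\<bar> \<le> H * n j ^ d"
          using abs_poly_le n_ge unfolding H_def d_def by blast
        also have "\<dots> \<le> H * (4 ^ z * (int m * (int J + 1))) ^ d"
          using n_le n_ge[of j] by (intro mult_left_mono power_mono) (auto simp: H_def sum_nonneg)
        finally have "real_of_int \<bar>poly F (n j)\<bar> \<le> real_of_int (H * (4 ^ z * (int m * (int J + 1))) ^ d)"
          by (simp only: of_int_le_iff)
        also have "\<dots> = (real_of_int H * (4 * real m * real D * real k + real m) ^ d) * (4 ^ z) ^ d"
        proof -
          have "4 * real m * real D * real k + real m = real m * (real J + 1)"
            by (simp add: J_def algebra_simps)
          then show ?thesis by (simp add: power_mult_distrib mult_ac)
        qed
        also have "\<dots> \<le> ((real_of_int H + 1) * (4 * real m * real D * real k + real m) ^ d) * (4 ^ z) ^ d"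
          by (intro mult_right_mono) auto
        also have "\<dots> < 2 powr (real k / 2) * (4 ^ z) ^ d"
          using elim(1) by (intro mult_strict_right_mono) auto
        also have "(4 ^ z) ^ d = (2 :: real) ^ (2 * z * d)"
          by (simp add: power_mult)
        also have "\<dots> = 2 powr real (2 * z * d)" by (rule powr_realpow[symmetric]) simp
        also have "\<dots> \<le> 2 powr (real k / 2)"
        proof -
          have "4 * (z * d) \<le> 4 * D * z" by (simp add: D_def)
          then have "4 * (z * d) \<le> k" using z(2) by linarith
          then have "real (4 * (z * d)) \<le> real k" by (simp only: of_nat_le_iff)
          then show ?thesis by simp
        qed
        also have "2 powr (real k / 2) * 2 powr (real k / 2) = 2 ^ k"
          by (simp add: powr_realpow flip: powr_add)
        finally have "real_of_int \<bar>poly F (n j)\<bar> < real_of_int (2 ^ k)" by simp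
        then show ?thesis by (simp only: of_int_less_iff)
      qed
      define A where "A = {q\<in>Q. z < q \<and> q < 2 ^ k}"
      have finA: "finite A" unfolding A_def by (rule finite_subset[of _ "{..<2^k}"]) auto
      have "card A \<le> card {q\<in>Q. q < 2 ^ k}"
        unfolding A_def by (intro card_mono finite_subset[of "{q\<in>Q. q < 2 ^ k}" "{..<2^k}"]) auto
      then have cardA: "card A \<le> k" using few by linarith
      have "{..<J} \<subseteq> (\<Union>q\<in>A. {j. j < J \<and> int q dvd poly F (n j)})"
      proof
        fix j assume "j \<in> {..<J}"
        then have "j < J" by simp
        obtain q where q: "q \<in> Q" "int q dvd poly F (n j)" using F(2) n_ge n_cong by blast
        have "z < q"
        proof (rule ccontr)
          assume "\<not> z < q"
          then have "q dvd M" unfolding M_def using q fin by (intro dvd_prodI) auto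
          then have "[n j = 0] (mod int q)" by (simp add: n_def cong_0_iff)
          then have "[poly F (n j) = poly F 0] (mod int q)" by (rule cong_poly)
          then show False using q Q(3) cong_dvd_iff by blast
        qed
        moreover have "int q \<le> \<bar>poly F (n j)\<bar>"
          using q(2) F(1)[OF n_ge n_cong] by (intro zdvd_imp_le) (auto simp: dvd_abs_iff)
        then have "int q < 2 ^ k" using small[OF \<open>j < J\<close>] by (rule le_less_trans)
        then have "int q < int (2 ^ k)" by (simp only: of_nat_power of_nat_numeral)
        then have "q < 2 ^ k" by (simp only: of_nat_less_iff)
        ultimately show "j \<in> (\<Union>q\<in>A. {j. j < J \<and> int q dvd poly F (n j)})"
          using q \<open>j < J\<close> by (auto simp: A_def)
      qed
      then have "card {..<J} \<le> card (\<Union>q\<in>A. {j. j < J \<and> int q dvd poly F (n j)})"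
        using finA by (intro card_mono) auto
      also have "\<dots> \<le> (\<Sum>q\<in>A. card {j. j < J \<and> int q dvd poly F (n j)})"
        using finA by (rule card_UN_le)
      also have "\<dots> \<le> (\<Sum>q\<in>A. (J div q + 1) * D)"
      proof (rule sum_mono)
        fix q assume "q \<in> A"
        then have q: "q \<in> Q" "z < q" by (auto simp: A_def)
        \<comment> \<open>Since \<open>q > z\<close>, the step \<open>M * m\<close> is invertible
          modulo \<open>q\<close>, as the count of roots along the progression requires.\<close>
        have "\<not> q dvd M"
        proof
          assume "q dvd M"
          then obtain q' where "q' \<in> Q" "q' \<le> z" "q dvd q'"
            using prime_dvd_prod_iff[OF fin Q(1)[OF q(1)]] unfolding M_def by auto
          then show False using q Q(1) primes_dvd_imp_eq by (metis not_less)
        qed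
        then have "\<not> int q dvd int M * int m"
          using Q(1,2)[OF q(1)] by (metis int_dvd_int_iff of_nat_mult prime_dvd_mult_iff)
        then have "card {j. j < J \<and> int q dvd poly F (n j)} \<le> (J div q + 1) * d"
          unfolding n_def d_def using Q(1,3)[OF q(1)]
          by (intro card_progression_roots_mod_prime[where x = 0]) auto
        also have "\<dots> \<le> (J div q + 1) * D" by (intro mult_le_mono2) (simp add: D_def)
        finally show "card {j. j < J \<and> int q dvd poly F (n j)} \<le> (J div q + 1) * D" .
      qed
      finally have "real J \<le> real (\<Sum>q\<in>A. (J div q + 1) * D)"
        by (simp only: of_nat_le_iff card_lessThan)
      also have "\<dots> \<le> (\<Sum>q\<in>A. (real J / real q + 1) * real D)"
        unfolding of_nat_sum of_nat_mult of_nat_add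
        by (intro sum_mono mult_right_mono add_mono of_nat_div_le_of_nat) auto
      also have "\<dots> = real D * (real J * (\<Sum>q\<in>A. 1 / real q) + real (card A))"
        by (simp add: sum.distrib sum_distrib_left algebra_simps)
      also have "\<dots> \<le> real D * (real J * (1 / (4 * real D) + 1 / (4 * real D)) + real k)"
      proof (intro mult_left_mono add_mono)
        have "(\<Sum>q\<in>A. 1 / real q) \<le> real (4 * D * k) * ln 4 / (real z * ln (real z)) + 1 / real (4 * D)"
          using finA cardA z(1) \<open>D > 0\<close> \<open>k > 0\<close> Q(1) by (intro sum_inverse_primes_le) (auto simp: A_def)
        also have "real (4 * D * k) * ln 4 / (real z * ln (real z)) \<le> 1 / (4 * real D)"
        proof -
          have "ln (real z) > 0" using z(1) by simp
          have "real k \<le> 8 * real D * real z"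
            using z(3) by (metis less_imp_le of_nat_le_iff of_nat_mult of_nat_numeral)
          then have "16 * real D ^ 2 * ln 4 * real k \<le> 16 * real D ^ 2 * ln 4 * (8 * real D * real z)"
            by (intro mult_left_mono) auto
          also have "\<dots> = real z * (128 * real D ^ 3 * ln 4)"
            by (simp add: power2_eq_square power3_eq_cube)
          also have "\<dots> \<le> real z * ln (real z)"
            using elim(2) by (intro mult_left_mono) (auto simp: z_def)
          finally show ?thesis
            using \<open>ln (real z) > 0\<close> \<open>D > 0\<close> z(1) by (simp add: field_simps power2_eq_square)
        qed
        finally show "(\<Sum>q\<in>A. 1 / real q) \<le> 1 / (4 * real D) + 1 / (4 * real D)" by simp
      qed (use cardA in auto)
      also have "\<dots> = real J * (3 / 4)"
        using \<open>D > 0\<close> by (simp add: J_def field_simps)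
      finally show False using \<open>J > 0\<close> by simp
    qed
  qed
qed

section \<open>Primes congruent to -1\<close>

lemma eventually_S1_ge:
  assumes "prime p"
  shows "\<forall>\<^sub>F k in sequentially. k \<le> S1 p (p ^ k - 1)"
proof -
  define Q where "Q = {q::nat. prime q \<and> q \<noteq> 3 \<and> [int q = -1] (mod int p)}"
  have p2: "p \<ge> 2" using assms prime_ge_2_nat by blast
  have "\<forall>\<^sub>F k in sequentially. k \<le> card {q\<in>Q. q < 2 ^ k}"
  proof (cases "p = 2")
    case True
    have Q_eq: "Q = {q. prime q \<and> q \<noteq> 2 \<and> q \<noteq> 3}"
    proof -
      have "[int q = -1] (mod 2) \<longleftrightarrow> odd q" for q
        by (simp add: cong_iff_dvd_diff)
      moreover have "odd q \<longleftrightarrow> q \<noteq> 2" if "prime q" for q :: nat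
        using that prime_odd_nat[of q] prime_ge_2_nat[of q] by (cases "q = 2") auto
      ultimately show ?thesis unfolding Q_def True by auto
    qed
    \<comment> \<open>Modulus 1 imposes no congruence condition. The values of
      \<open>6 * n + 1\<close> avoid the primes 2 and 3, and the constant term 1 has no prime
      divisor.\<close>
    show ?thesis
    proof (rule eventually_card_prime_divisors_ge[where F = "[:1, 6:]" and m = 1 and r = 0])
      fix n :: int assume n: "n \<ge> 1"
      then show "poly [:1, 6:] n \<noteq> 0" by simp
      have "nat (6 * n + 1) \<noteq> 1" using n by simp
      then obtain q where q: "prime q" "q dvd nat (6 * n + 1)" using prime_factor_nat by blast
      then have dvd: "int q dvd 6 * n + 1" using n int_dvd_int_iff[of q "nat (6 * n + 1)"] by simp
      have "\<not> 2 dvd 6 * n + 1" "\<not> 3 dvd 6 * n + 1" by presburger+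
      then have "q \<noteq> 2" "q \<noteq> 3" using dvd by auto
      then have "q \<in> Q" using q by (simp add: Q_eq)
      with dvd show "\<exists>q\<in>Q. int q dvd poly [:1, 6:] n" by (intro bexI[of _ q]) (auto simp: algebra_simps)
    qed (auto simp: Q_eq)
  next
    case False
    then have "odd p" using assms p2 prime_odd_nat[of p] by auto
    obtain r where r: "\<And>x. [x = r] (mod int p) \<Longrightarrow> [pellB x p = -1] (mod int p)"
      using pellB_cong_minus_one[OF assms \<open>odd p\<close>] by blast
    define F where "F = pellB [:0, 1 :: int:] p"
    have F: "poly F x = pellB x p" for x by (simp add: F_def poly_pell)
    \<comment> \<open>For odd \<open>p\<close> the exclusion of 3 is harmless: 3 being -1 modulo
      \<open>p\<close> would force \<open>p\<close> to divide 4.\<close>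
    have Q_eq: "q \<in> Q \<longleftrightarrow> prime q \<and> [int q = -1] (mod int p)" for q
    proof -
      have "\<not> [int 3 = -1] (mod int p)"
      proof
        assume "[int 3 = -1] (mod int p)"
        then have "int p dvd int 4" by (simp add: cong_iff_dvd_diff)
        then have "p dvd 2 ^ 2" by (simp only: int_dvd_int_iff) simp
        then have "p dvd 2" using assms prime_dvd_power by blast
        then show False using p2 False dvd_imp_le[of p 2] by simp
      qed
      then show ?thesis by (auto simp: Q_def)
    qed
    show ?thesis
    proof (rule eventually_card_prime_divisors_ge[where F = F and m = p and r = r])
      fix q assume "q \<in> Q"
      then have q: "prime q" "[int q = -1] (mod int p)" by (auto simp: Q_eq)
      show "prime q" by (rule q)
      show "\<not> q dvd p"
      proof
        assume "q dvd p"
        then have "q = p" using q(1) assms primes_dvd_imp_eq by blast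
        then have "int p dvd 1" using q(2) by (simp add: cong_iff_dvd_diff)
        then show False using p2 by simp
      qed
      obtain j where "p = Suc (2 * j)" using \<open>odd p\<close> by (auto elim: oddE)
      then have "poly F 0 = (-1) ^ j" unfolding F using pellB_odd_index(2) by blast
      then have "\<bar>poly F 0\<bar> = 1" by (simp add: power_abs)
      then show "\<not> int q dvd poly F 0"
        using prime_gt_1_nat[OF q(1)] by (metis dvd_abs_iff of_nat_1 int_dvd_int_iff nat_dvd_1_iff_1 less_irrefl)
    next
      fix n :: int assume n: "n \<ge> 1" "[n = r] (mod int p)"
      show "poly F n \<noteq> 0" unfolding F using pellB_pos[of n p] n(1) p2 by simp
      show "\<exists>q\<in>Q. int q dvd poly F n"
        unfolding F using pellB_has_divisor[OF assms \<open>odd p\<close> n(1) r[OF n(2)]] Q_eq by blast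
    qed (use p2 in simp)
  qed
  then show ?thesis
  proof eventually_elim
    case (elim k)
    \<comment> \<open>The sieve counts primes below \<open>2 ^ k\<close>, which is at most
      \<open>p ^ k\<close>.\<close>
    have "(2::nat) ^ k \<le> p ^ k" using p2 by (rule power_mono) simp
    then have "{q\<in>Q. q < 2 ^ k} \<subseteq> {q. q \<le> p ^ k - 1 \<and> prime q \<and> q \<noteq> 3 \<and> [int q = -1] (mod int p)}"
      by (auto simp: Q_def)
    moreover have "finite {q. q \<le> p ^ k - 1 \<and> prime q \<and> q \<noteq> 3 \<and> [int q = -1] (mod int p)}"
      by (rule finite_subset[of _ "{..p ^ k - 1}"]) auto
    ultimately show ?case unfolding S1_def using elim card_mono order_trans by blast
  qed
qed

section \<open>From the prime count to the valuations\<close>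

lemma S1_mono: "m \<le> n \<Longrightarrow> S1 p m \<le> S1 p n"
  unfolding S1_def by (rule card_mono) (auto intro: finite_subset[of _ "{..n}"])

theorem theorem7p3:
  shows "(\<forall>p::nat. prime p \<longrightarrow> (\<exists>t. t0_admissible p t)) \<and>
         (\<forall>P0::real. 2 \<le> P0 \<longrightarrow>
           (\<forall>n::nat. Nstar P0 \<le> n \<longrightarrow>
             (\<forall>p::nat. prime p \<and> real p \<le> P0 \<longrightarrow> delta1 p n = 0)))"
proof -
  have ex: "\<exists>t. t0_admissible p t" if p: "prime p" for p
  proof -
    obtain K where "\<forall>k\<ge>K. k \<le> S1 p (p ^ k - 1)"
      using eventually_S1_ge[OF p] unfolding eventually_sequentially by blast
    then have "t0_admissible p (max 1 K)" by (simp add: t0_admissible_def)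
    then show ?thesis by blast
  qed
  moreover have "delta1 p n = 0" if n: "Nstar P0 \<le> n" and p: "prime p" "real p \<le> P0" for P0 n p
  proof -
    let ?v = "multiplicity p n"
    \<comment> \<open>Finiteness makes \<open>Max\<close> an upper bound for every member.\<close>
    have "{p ^ t0 p |p. prime p \<and> real p \<le> P0} \<subseteq> (\<lambda>p. p ^ t0 p) ` {..nat \<lfloor>P0\<rfloor>}"
      by (auto simp: le_nat_floor)
    then have "finite {p ^ t0 p |p. prime p \<and> real p \<le> P0}"
      by (rule finite_subset) simp
    then have "p ^ t0 p \<le> Nstar P0"
      unfolding Nstar_def using p by (intro Max_ge) auto
    then have t0_le: "p ^ t0 p \<le> n" using n by simp
    have "t0_admissible p (t0 p)"
      unfolding t0_def using ex[OF p(1)] by (rule LeastI_ex)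
    then have S1: "k \<le> S1 p (p ^ k - 1)" if "k \<ge> t0 p" for k
      using that by (simp add: t0_admissible_def)
    have "n > 0" using t0_le p(1) prime_gt_0_nat by (metis le_zero_eq power_eq_0_iff not_gr0)
    then have "p ^ ?v \<le> n" by (intro dvd_imp_le multiplicity_dvd)
    with t0_le have "p ^ max ?v (t0 p) \<le> n" by (simp add: max_def)
    then have "S1 p (p ^ max ?v (t0 p) - 1) \<le> S1 p (n - 1)"
      by (intro S1_mono diff_le_mono)
    then have "?v \<le> S1 p (n - 1)" using S1[of "max ?v (t0 p)"] by simp
    then show ?thesis by (simp add: delta1_def)
  qed
  ultimately show ?thesis by blast
qed

end
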